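(* For every integer $n\geq 9$ there exists a $3$-strong digraph $D$ of order $n$ with minimum degree at least $n+1$ (i.e. $d(x)\geq n+1$ for every vertex $x$) which is not strongly Hamiltonian-connected.
   Context: All digraphs are finite, without loops and without multiple arcs (opposite arcs $xy$ and $yx$ may both be present). For a vertex $x$, $d(x)=d^+(x)+d^-(x)$ is the sum of its out-degree and in-degree. A digraph $D$ is $k$-strong if $|V(D)|\geq k+1$ and $D-A$ is strongly connected for every set $A$ of at most $k-1$ vertices. A path is Hamiltonian if it contains all vertices. A digraph is strongly Hamiltonian-connected if for every ordered pair of distinct vertices $x,y$ there is a Hamiltonian path from $x$ to $y$. *)

theory Defs
  imports "Graph_Theory.Graph_Theory"
begin

definition total_degree :: "('a, 'b) pre_digraph \<Rightarrow> 'a \<Rightarrow> nat" where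
  "total_degree D x = out_degree D x + in_degree D x"

text \<open>``At most \<open>k - 1\<close> vertices'' is written \<open>card A < k\<close>, avoiding truncated subtraction at \<open>k = 0\<close>.
  The first conjunct forces \<open>verts D\<close> to be finite, since infinite sets have \<open>card\<close> zero.\<close>

definition k_strong :: "nat \<Rightarrow> ('a, 'b) pre_digraph \<Rightarrow> bool" where
  "k_strong k D \<longleftrightarrow> card (verts D) \<ge> k + 1 \<and>
     (\<forall>A \<subseteq> verts D. card A < k \<longrightarrow> strongly_connected (D \<restriction> (verts D - A)))"

text \<open>A path is given by its list of arcs; the vertices on it are
  \<open>pre_digraph.awalk_verts D x p\<close>, which has the single entry \<open>x\<close> for \<open>p = []\<close>.\<close>

definition hamiltonian_path :: "('a, 'b) pre_digraph \<Rightarrow> 'a \<Rightarrow> 'b list \<Rightarrow> 'a \<Rightarrow> bool" where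
  "hamiltonian_path D x p y \<longleftrightarrow>
     pre_digraph.apath D x p y \<and> set (pre_digraph.awalk_verts D x p) = verts D"

definition strongly_hamiltonian_connected :: "('a, 'b) pre_digraph \<Rightarrow> bool" where
  "strongly_hamiltonian_connected D \<longleftrightarrow>
     (\<forall>x \<in> verts D. \<forall>y \<in> verts D. x \<noteq> y \<longrightarrow> (\<exists>p. hamiltonian_path D x p y))"

end

theory Submission
  imports Defs
begin

text \<open>Arcs into \<open>x\<close> and arcs out of \<open>y\<close> lie on no path from \<open>x\<close> to \<open>y\<close>, so all of them can be present to
  help connectivity and degrees. The remaining arcs are such that a Hamiltonian path from \<open>x\<close> to \<open>y\<close>
  starts with \<open>x p\<close> or \<open>x q\<close>, ends with \<open>p y\<close> or \<open>s y\<close>, reaches \<open>s\<close> from \<open>p\<close> or \<open>e\<close>, first enters a set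
  \<open>B\<close> from \<open>e\<close> or \<open>s\<close>, and leaves a set \<open>C\<close> for the last time towards \<open>q\<close> or \<open>e\<close>. If it starts with
  \<open>x p\<close>, it ends with \<open>e s y\<close> and cannot enter \<open>B\<close>. If it starts with \<open>x q\<close>, all of \<open>C\<close> comes before \<open>e\<close>.
  It then contains \<open>p s y\<close> with \<open>B\<close> entered from \<open>e\<close>, or \<open>e s\<close> and \<open>p y\<close> with \<open>B\<close> entered from \<open>s\<close>;
  either way \<open>B\<close> comes after \<open>e\<close>, and \<open>C\<close>, which can be entered only from \<open>p\<close>, \<open>e\<close>, \<open>s\<close> and \<open>B\<close>, is
  never reached.\<close>

text \<open>The vertices \<open>x, y, p, q, e, s\<close> are \<open>0, \<dots>, 5\<close>, and \<open>B\<close>, \<open>C\<close> cover the rest. All arcs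
  compatible with the argument above are present. The sets may overlap: \<open>B = C\<close> is used for \<open>n = 9\<close>,
  where no disjoint choice meets the degree bound.\<close>

definition adj :: "nat set \<Rightarrow> nat set \<Rightarrow> nat \<Rightarrow> nat \<Rightarrow> bool" where
  "adj B C u v \<longleftrightarrow> u \<noteq> v \<and>
     (u = 0 \<longrightarrow> v \<in> {1, 2, 3}) \<and>
     (v = 1 \<longrightarrow> u \<in> {0, 2, 5}) \<and>
     (v = 5 \<longrightarrow> u \<in> {1, 2, 4}) \<and>
     (v \<in> B \<longrightarrow> u \<in> {1, 4, 5} \<union> B) \<and>
     (u \<in> C \<longrightarrow> v \<in> {0, 3, 4} \<union> C) \<and>
     (v \<in> C \<longrightarrow> u \<noteq> 3)"

definition adj_digraph :: "nat \<Rightarrow> nat set \<Rightarrow> nat set \<Rightarrow> (nat, nat \<times> nat) pre_digraph" where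
  "adj_digraph n B C =
     \<lparr>verts = {..<n}, arcs = {(u, v). u < n \<and> v < n \<and> adj B C u v}, tail = fst, head = snd\<rparr>"

lemma adj_digraph_simps [simp]:
  "verts (adj_digraph n B C) = {..<n}"
  "arcs (adj_digraph n B C) = {(u, v). u < n \<and> v < n \<and> adj B C u v}"
  "tail (adj_digraph n B C) = fst"
  "head (adj_digraph n B C) = snd"
  by (simp_all add: adj_digraph_def)

lemma digraph_adj_digraph: "digraph (adj_digraph n B C)"
proof
  have "arcs (adj_digraph n B C) \<subseteq> {..<n} \<times> {..<n}"
    by auto
  then show "finite (arcs (adj_digraph n B C))"
    by (rule finite_subset) simp
  show "tail (adj_digraph n B C) a \<noteq> head (adj_digraph n B C) a"
    if "a \<in> arcs (adj_digraph n B C)" for a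
    using that by (clarsimp simp: adj_def)
qed (auto simp: arc_to_ends_def)

section \<open>Absence of a Hamiltonian path from \<open>0\<close> to \<open>1\<close>\<close>

text \<open>\<open>pos v\<close> stands for the index of \<open>v\<close> on a supposed Hamiltonian
  path. Consecutive vertices become equations between indices, and the case analysis becomes
  arithmetic.\<close>

lemma no_ordering:
  fixes pos :: "nat \<Rightarrow> nat"
  assumes n: "6 \<le> n"
    and B: "B \<noteq> {}" and C: "C \<noteq> {}" and BC: "B \<union> C = {6..<n}"
    and inj: "inj_on pos {..<n}"
    and first: "pos 0 = 0" and last: "\<And>v. v < n \<Longrightarrow> pos v \<le> pos 1"
    and succ: "\<And>u. u < n \<Longrightarrow> u \<noteq> 1 \<Longrightarrow> \<exists>v<n. adj B C u v \<and> pos v = Suc (pos u)"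
    and pred: "\<And>v. v < n \<Longrightarrow> v \<noteq> 0 \<Longrightarrow> \<exists>u<n. adj B C u v \<and> pos v = Suc (pos u)"
  shows False
proof -
  have pos_eq: "pos u = pos v \<longleftrightarrow> u = v" if "u < n" "v < n" for u v
    using inj that by (auto simp: inj_on_def)
  have no_succ_1: "pos v \<noteq> Suc (pos 1)" if "v < n" for v
    using last[OF that] by simp
  \<comment> \<open>\<open>b\<close> and \<open>c\<close> come first in \<open>B\<close> and
    \<open>C\<close>, and \<open>d\<close> comes last in \<open>C\<close>, so the predecessors of
    \<open>b\<close> and \<open>c\<close> and the successor of \<open>d\<close> lie outside these
    sets.\<close>
  obtain b where b: "b \<in> B" "\<And>v. v \<in> B \<Longrightarrow> pos b \<le> pos v"
    using ex_has_least_nat[of "\<lambda>v. v \<in> B" _ pos] B by blast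
  obtain c where c: "c \<in> C" "\<And>v. v \<in> C \<Longrightarrow> pos c \<le> pos v"
    using ex_has_least_nat[of "\<lambda>v. v \<in> C" _ pos] C by blast
  have "\<forall>v. v \<in> C \<longrightarrow> pos v < Suc (pos 1)"
    using BC last by (metis UnCI atLeastLessThan_iff less_Suc_eq_le)
  then obtain d where d: "d \<in> C" "\<And>v. v \<in> C \<Longrightarrow> pos v \<le> pos d"
    using ex_has_greatest_nat[of "\<lambda>v. v \<in> C" _ pos] C by blast
  have lt: "b < n" "c < n" "d < n" "6 \<le> b" "6 \<le> c" "6 \<le> d"
    using b(1) c(1) d(1) BC by (metis UnCI atLeastLessThan_iff)+
  have in_b: "pos b = Suc (pos 4) \<or> pos b = Suc (pos 5)"
  proof -
    obtain u where u: "u < n" "adj B C u b" "pos b = Suc (pos u)"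
      using pred[of b] lt by auto
    moreover have "u \<notin> B"
      using b(2)[of u] u(3) by auto
    ultimately show ?thesis
      using b(1) no_succ_1[of b] lt by (auto simp: adj_def)
  qed
  have out_d: "pos 3 = Suc (pos d) \<or> pos 4 = Suc (pos d)"
  proof -
    obtain v where v: "v < n" "adj B C d v" "pos v = Suc (pos d)"
      using succ[of d] lt by auto
    moreover have "v \<notin> C"
      using d(2)[of v] v(3) by auto
    ultimately show ?thesis
      using d(1) first by (auto simp: adj_def)
  qed
  have in_c: "\<exists>u<n. pos c = Suc (pos u) \<and> (u = 2 \<or> u = 4 \<or> u = 5 \<or> u \<in> B)"
  proof -
    obtain u where u: "u < n" "adj B C u c" "pos c = Suc (pos u)"
      using pred[of c] lt by auto
    moreover have "u \<notin> C"
      using c(2)[of u] u(3) by auto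
    moreover have "u \<noteq> 1"
      using no_succ_1[of c] u(3) lt by auto
    moreover have "u < 6 \<or> u \<in> B"
      using u(1) \<open>u \<notin> C\<close> BC by auto
    ultimately show ?thesis
      using c(1) lt by (auto simp: adj_def)
  qed
  have in_5: "pos 5 = Suc (pos 2) \<or> pos 5 = Suc (pos 4)"
    using pred[of 5] no_succ_1[of 5] n by (auto simp: adj_def)
  have in_1: "pos 1 = Suc (pos 2) \<or> pos 1 = Suc (pos 5)"
  proof -
    \<comment> \<open>Otherwise \<open>1\<close> has index 1, and no index is left for
      \<open>2\<close> and \<open>3\<close>.\<close>
    have "pos 1 \<noteq> Suc (pos 0)"
      using last[of 2] last[of 3] first pos_eq[of 2 1] pos_eq[of 3 1] pos_eq[of 2 0] pos_eq[of 3 0]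
        pos_eq[of 2 3] n
      by auto
    then show ?thesis
      using pred[of 1] n by (auto simp: adj_def)
  qed
  have out_0: "pos 2 = 1 \<or> pos 3 = 1"
  proof -
    have "pos 1 \<noteq> Suc (pos 0)"
      using in_1 first pos_eq[of 2 0] pos_eq[of 5 0] n by auto
    then show ?thesis
      using succ[of 0] first n by (auto simp: adj_def)
  qed
  show False
    using out_0
  proof
    \<comment> \<open>Since \<open>3\<close> still needs an index, the path is neither
      \<open>0 2 1\<close> nor \<open>0 2 5 1\<close>. So it ends in \<open>4 5 1\<close>, and
      neither \<open>4\<close> nor \<open>5\<close> can directly precede \<open>b\<close>.\<close>
    assume "pos 2 = 1"
    then show False
      using in_1 in_5 in_b first last[of 3] pos_eq[of 3 0] pos_eq[of 3 1] pos_eq[of 3 2] pos_eq[of 3 5]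
        pos_eq[of 5 b] pos_eq[of 1 b] lt n
      by auto
  next
    assume "pos 3 = 1"
    then have "pos 4 = Suc (pos d)"
      using out_d first pos_eq[of d 0] lt by auto
    then have c4: "pos c < pos 4"
      using c(1) d(2) by (simp add: less_Suc_eq_le)
    obtain u where u: "u < n" "pos c = Suc (pos u)" "u = 2 \<or> u = 4 \<or> u = 5 \<or> u \<in> B"
      using in_c by blast
    \<comment> \<open>All of \<open>B\<close> comes after \<open>4\<close>, but \<open>c\<close>
      comes before it, so \<open>u\<close> is neither \<open>4\<close> nor in \<open>B\<close>. Nor
      is it \<open>2\<close>, which is followed by \<open>5\<close> or \<open>1\<close>, or
      \<open>5\<close>, which is followed by \<open>1\<close> or comes after
      \<open>4\<close>.\<close>
    have "u \<in> B \<Longrightarrow> pos b \<le> pos u"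
      by (rule b(2))
    then show False
      using in_1 in_5 in_b c4 u(2,3) pos_eq[of 5 b] pos_eq[of 1 b] pos_eq[of 5 c] pos_eq[of 1 c]
        pos_eq[of 1 5] lt n
      by auto
  qed
qed

text \<open>The index function of the vertex list of such a path satisfies the hypotheses of
  \<open>no_ordering\<close>.\<close>

lemma no_hamiltonian_path:
  assumes n: "6 \<le> n" and B: "B \<noteq> {}" and C: "C \<noteq> {}" and BC: "B \<union> C = {6..<n}"
  shows "\<not> hamiltonian_path (adj_digraph n B C) 0 p 1"
proof
  assume ham: "hamiltonian_path (adj_digraph n B C) 0 p 1"
  interpret digraph "adj_digraph n B C"
    by (rule digraph_adj_digraph)
  define L where "L = awalk_verts 0 p"
  have walk: "awalk 0 p 1" and L: "distinct L" "set L = {..<n}"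
    using ham by (auto simp: hamiltonian_path_def apath_def L_def)
  have len: "length L = n"
    using distinct_card[OF L(1)] L(2) by simp
  have ends: "hd L = 0" "List.last L = 1"
    using walk by (auto simp: L_def)
  have cas_adj: "adj B C (awalk_verts u q ! i) (awalk_verts u q ! Suc i)"
    if "cas u q w" "set q \<subseteq> arcs (adj_digraph n B C)" "i < length q" for u q w i
    using that
  proof (induction q arbitrary: u i)
    case (Cons a q)
    then show ?case
      by (cases i; cases q) (auto simp: awalk_verts_conv)
  qed simp
  have L_adj: "adj B C (L ! i) (L ! Suc i)" if "Suc i < n" for i
    using cas_adj[of 0 p 1 i] walk that len unfolding L_def awalk_def length_awalk_verts by simp
  \<comment> \<open>An index is chosen for each vertex; distinctness of \<open>L\<close> then makes
    \<open>pos\<close> a two-sided inverse of indexing.\<close>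
  have "\<forall>v\<in>{..<n}. \<exists>i. i < n \<and> L ! i = v"
    using L(2) len by (metis in_set_conv_nth)
  then obtain pos where pos: "\<And>v. v < n \<Longrightarrow> pos v < n \<and> L ! pos v = v"
    unfolding bchoice_iff by auto
  have pos_nth: "pos (L ! i) = i" if "i < n" for i
    using pos[of "L ! i"] that L len nth_eq_iff_index_eq[of L] by (metis lessThan_iff nth_mem)
  have L_nth: "L ! 0 = 0" "L ! (n - 1) = 1"
    using ends len n by (metis hd_conv_nth last_conv_nth list.size(3) not_numeral_le_zero)+
  show False
  proof (rule no_ordering[OF n B C BC, of pos])
    show "inj_on pos {..<n}"
      using pos by (metis inj_onI lessThan_iff)
    show "pos 0 = 0" 
      using pos_nth[of 0] L_nth n by simp
    have pos_1: "pos 1 = n - 1"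
      using pos_nth[of "n - 1"] L_nth n by simp
    show "pos v \<le> pos 1" if "v < n" for v
      using pos[OF that] pos_1 by linarith
    show "\<exists>v<n. adj B C u v \<and> pos v = Suc (pos u)" if "u < n" "u \<noteq> 1" for u
    proof -
      have "pos u \<noteq> n - 1"
        using pos[OF that(1)] that(2) L_nth by auto
      then have "Suc (pos u) < n"
        using pos[OF that(1)] by auto
      then show ?thesis
        using L_adj[of "pos u"] pos[OF that(1)] pos_nth[of "Suc (pos u)"] L len
        by (metis lessThan_iff nth_mem)
    qed
    show "\<exists>u<n. adj B C u v \<and> pos v = Suc (pos u)" if "v < n" "v \<noteq> 0" for v
    proof -
      have "pos v \<noteq> 0"
        using pos[OF that(1)] that(2) L_nth by (metis)
      then obtain i where i: "pos v = Suc i"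
        by (cases "pos v") auto
      then have "i < n" "Suc i < n"
        using pos[OF that(1)] by auto
      then show ?thesis
        using L_adj[of i] pos[OF that(1)] pos_nth[of i] L len i
        by (metis lessThan_iff nth_mem)
    qed
  qed
qed

section \<open>Degree bounds and 3-strong connectivity\<close>

text \<open>Listing enough neighbours suffices: the arcs to \<open>S\<close> and from
  \<open>T\<close> correspond to their elements.\<close>

lemma total_degree_ge:
  assumes v: "v < n"
    and out: "S \<subseteq> {..<n}" "\<And>w. w \<in> S \<Longrightarrow> adj B C v w"
    and into: "T \<subseteq> {..<n}" "\<And>w. w \<in> T \<Longrightarrow> adj B C w v"
  shows "card S + card T \<le> total_degree (adj_digraph n B C) v"
proof -
  interpret digraph "adj_digraph n B C"
    by (rule digraph_adj_digraph)
  have "card (Pair v ` S) \<le> out_degree (adj_digraph n B C) v"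
    unfolding out_degree_def using v out by (intro card_mono) auto
  moreover have "card ((\<lambda>w. (w, v)) ` T) \<le> in_degree (adj_digraph n B C) v"
    unfolding in_degree_def using v into by (intro card_mono) auto
  ultimately show ?thesis
    by (simp add: total_degree_def card_image inj_on_def)
qed

text \<open>Vertex \<open>4\<close> has arcs to all others except \<open>1\<close> and from all
  others except \<open>0\<close>; each exception is bridged by one of three vertices, not all in
  \<open>A\<close>. If \<open>4\<close> is removed, at most one more vertex is, and the routes use
  that all other vertices have arcs to \<open>0\<close> and from \<open>1\<close>.\<close>

lemma k_strong_adj_digraph:
  assumes n: "6 \<le> n" and BC: "B \<union> C = {6..<n}"
  shows "k_strong 3 (adj_digraph n B C)"
  unfolding k_strong_def
proof (intro conjI allI impI)
  show "3 + 1 \<le> card (verts (adj_digraph n B C))"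
    using n by simp
next
  fix A
  assume A: "A \<subseteq> verts (adj_digraph n B C)" "card A < 3"
  let ?H = "adj_digraph n B C \<restriction> (verts (adj_digraph n B C) - A)"
  interpret D: digraph "adj_digraph n B C"
    by (rule digraph_adj_digraph)
  interpret H: wf_digraph ?H
    by (rule D.wellformed_induce_subgraph)
  have small: "v \<notin> B" "v \<notin> C" if "v < 6" for v
    using BC that by (metis UnCI atLeastLessThan_iff not_less)+
  have finA: "finite A"
    using A finite_subset by fastforce
  \<comment> \<open>Allowing \<open>u = v\<close> avoids separate cases when an endpoint already
    lies on the route.\<close>
  have step: "u \<rightarrow>\<^sup>*\<^bsub>?H\<^esub> v" if "adj B C u v \<or> u = v" "u < n" "v < n" "u \<notin> A" "v \<notin> A" for u v
  proof (cases "u = v")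
    case False
    then have "u \<rightarrow>\<^bsub>?H\<^esub> v"
      using that by (force simp: arcs_ends_conv)
    then show ?thesis
      by (rule H.reachable_adjI)
  qed (use that in \<open>auto simp del: adj_digraph_simps intro!: H.reachable_refl\<close>, simp)
  have step': "u \<rightarrow>\<^sup>*\<^bsub>?H\<^esub> v"
    if "u \<rightarrow>\<^sup>*\<^bsub>?H\<^esub> w" "adj B C w v \<or> w = v" "v < n" "v \<notin> A" for u v w
    using H.reachable_trans[OF that(1) step[OF that(2)]] that reachable_in_vertsE[OF that(1)] by auto
  have not_in: "\<exists>w\<in>W. w \<notin> A" if "card W = 3" for W
    using card_mono[OF finA, of W] that A(2) by (auto simp: subset_iff)
  have "u \<rightarrow>\<^sup>*\<^bsub>?H\<^esub> v" if u: "u < n" "u \<notin> A" and v: "v < n" "v \<notin> A" for u v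
  proof (cases "4 \<in> A")
    case False
    have "u \<rightarrow>\<^sup>*\<^bsub>?H\<^esub> 4"
    proof (cases "u = 0")
      case True
      obtain w where w: "w \<in> {1, 2, 3}" "w \<notin> A"
        using not_in[of "{1, 2, 3}"] by auto
      then have "u \<rightarrow>\<^sup>*\<^bsub>?H\<^esub> w"
        using step[of u w] True u n by (auto simp: adj_def small)
      then show ?thesis
        by (rule step') (use w False n in \<open>auto simp: adj_def small\<close>)
    next
      case u0: False
      show ?thesis
        by (rule step) (use u0 u False n in \<open>auto simp: adj_def small\<close>)
    qed
    also have "4 \<rightarrow>\<^sup>*\<^bsub>?H\<^esub> v"
    proof (cases "v = 1")
      case True
      obtain w where w: "w \<in> {0, 2, 5}" "w \<notin> A"
        using not_in[of "{0, 2, 5}"] by auto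
      then have "4 \<rightarrow>\<^sup>*\<^bsub>?H\<^esub> w"
        using step[of 4 w] False n by (auto simp: adj_def small)
      then show ?thesis
        by (rule step') (use w v True n in \<open>auto simp: adj_def small\<close>)
    next
      case v1: False
      show ?thesis
        by (rule step) (use v1 v False n in \<open>auto simp: adj_def small\<close>)
    qed
    finally (H.reachable_trans) show ?thesis .
  next
    case True
    have to_0: "u \<rightarrow>\<^sup>*\<^bsub>?H\<^esub> 0" if "0 \<notin> A"
      by (rule step) (use that u n in \<open>auto simp: adj_def small\<close>)
    have from_1: "1 \<rightarrow>\<^sup>*\<^bsub>?H\<^esub> v" if "1 \<notin> A"
      by (rule step) (use that v n in \<open>auto simp: adj_def small\<close>)
    have A_eq: "A = {4, w}" if "w \<in> A" "w \<noteq> 4" for w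
    proof -
      have "card A \<le> card {4, w}"
        using A(2) that(2) by simp
      then show ?thesis
        using card_seteq[OF finA, of "{4, w}"] True that(1) by simp
    qed
    consider "0 \<notin> A" "1 \<notin> A" | "A = {4, 0}" | "A = {4, 1}"
      using A_eq[of 0] A_eq[of 1] by fastforce
    then show ?thesis
    proof cases
      case 1
      have "0 \<rightarrow>\<^sup>*\<^bsub>?H\<^esub> 1"
        by (rule step) (use 1 n in \<open>auto simp: adj_def small\<close>)
      then show ?thesis
        using to_0 from_1 1 H.reachable_trans by blast
    next
      case 2
      \<comment> \<open>With \<open>0\<close> missing, \<open>3\<close> replaces it as a vertex with
        arcs from all others.\<close>
      have "u \<rightarrow>\<^sup>*\<^bsub>?H\<^esub> 3"
        by (rule step) (use u 2 n in \<open>auto simp: adj_def small\<close>)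
      then have "u \<rightarrow>\<^sup>*\<^bsub>?H\<^esub> 2"
        by (rule step') (use 2 n in \<open>auto simp: adj_def small\<close>)
      then have "u \<rightarrow>\<^sup>*\<^bsub>?H\<^esub> 1"
        by (rule step') (use 2 n in \<open>auto simp: adj_def small\<close>)
      then show ?thesis
        by (rule H.reachable_trans) (rule from_1, simp add: 2)
    next
      case 3
      \<comment> \<open>With \<open>1\<close> missing, \<open>5\<close> replaces it as a vertex with
        arcs to all others.\<close>
      have "0 \<rightarrow>\<^sup>*\<^bsub>?H\<^esub> 2"
        by (rule step) (use 3 n in \<open>auto simp: adj_def small\<close>)
      then have "0 \<rightarrow>\<^sup>*\<^bsub>?H\<^esub> 5"
        by (rule step') (use 3 n in \<open>auto simp: adj_def small\<close>)
      then have "0 \<rightarrow>\<^sup>*\<^bsub>?H\<^esub> v"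
        by (rule step') (use v 3 n in \<open>auto simp: adj_def small\<close>)
      with to_0 show ?thesis
        by (rule H.reachable_trans) (simp add: 3)
    qed
  qed
  moreover have "verts ?H \<noteq> {}"
    using card_mono[OF finA, of "{..<n}"] A(2) n by auto
  ultimately show "strongly_connected ?H"
    unfolding strongly_connected_def by simp
qed

text \<open>For disjoint \<open>B\<close> and \<open>C\<close>, their vertices have degrees
  \<open>n - 1 + card B\<close> and \<open>n - 1 + card C\<close>. So both sets need two elements,
  which is possible from \<open>n = 10\<close> on.\<close>

lemma total_degree_ge_10:
  assumes n: "10 \<le> n" and v: "v < n"
  shows "n + 1 \<le> total_degree (adj_digraph n {6..<8} {8..<n}) v"
proof -
  have *: ?thesis
    if "S \<subseteq> {..<n}" "\<And>w. w \<in> S \<Longrightarrow> adj {6..<8} {8..<n} v w"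
      "T \<subseteq> {..<n}" "\<And>w. w \<in> T \<Longrightarrow> adj {6..<8} {8..<n} w v" "n + 1 \<le> card S + card T"
    for S T
    using total_degree_ge[OF v that(1-4)] that(5) by simp
  consider "v = 0" | "v = 1" | "v = 2" | "v = 3" | "v = 4" | "v = 5" | "v \<in> {6..<8}" | "v \<in> {8..<n}"
    using v by fastforce
  then show ?thesis
  proof cases
    case 1
    show ?thesis
      by (rule *[of "{1, 2, 3}" "{1..<n}"]) (use 1 n in \<open>auto simp: adj_def\<close>)
  next
    case 2
    show ?thesis
      by (rule *[of "insert 0 {2..<n}" "{0, 2, 5}"]) (use 2 n in \<open>auto simp: adj_def\<close>)
  next
    case 3
    show ?thesis
      by (rule *[of "{0, 1, 3, 4, 5} \<union> {8..<n}" "{0, 1, 3, 4, 5, 6, 7}"])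
        (use 3 n in \<open>auto simp: adj_def\<close>)
  next
    case 4
    show ?thesis
      by (rule *[of "{0, 2, 4}" "{0, 1, 2, 4, 5} \<union> {6..<n}"]) (use 4 n in \<open>auto simp: adj_def\<close>)
  next
    case 5
    show ?thesis
      by (rule *[of "{0, 2, 3, 5} \<union> {6..<n}" "{1, 2, 3, 5} \<union> {6..<n}"])
        (use 5 n in \<open>auto simp: adj_def\<close>)
  next
    case 6
    show ?thesis
      by (rule *[of "{0, 1, 2, 3, 4} \<union> {6..<n}" "{1, 2, 4}"]) (use 6 n in \<open>auto simp: adj_def\<close>)
  next
    case 7
    show ?thesis
      by (rule *[of "{0, 2, 3, 4} \<union> ({6..<n} - {v})" "{1, 4, 5} \<union> ({6..<8} - {v})"])
        (use 7 n in \<open>auto simp: adj_def\<close>)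
  next
    case 8
    show ?thesis
      by (rule *[of "{0, 3, 4} \<union> ({8..<n} - {v})" "{1, 2, 4, 5} \<union> ({6..<n} - {v})"])
        (use 8 n in \<open>auto simp: adj_def\<close>)
  qed
qed

text \<open>With \<open>B = C\<close>, each of its three vertices has arcs to \<open>0\<close>,
  \<open>3\<close>, \<open>4\<close>, from \<open>1\<close>, \<open>4\<close>, \<open>5\<close>, and
  both ways to the other two: exactly 10. Vertex \<open>2\<close> also has degree exactly
  10.\<close>

lemma total_degree_ge_9:
  assumes v: "v < 9"
  shows "10 \<le> total_degree (adj_digraph 9 {6..<9} {6..<9}) v"
proof -
  have *: ?thesis
    if "S \<subseteq> {..<9}" "\<And>w. w \<in> S \<Longrightarrow> adj {6..<9} {6..<9} v w"
      "T \<subseteq> {..<9}" "\<And>w. w \<in> T \<Longrightarrow> adj {6..<9} {6..<9} w v" "10 \<le> card S + card T"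
    for S T
    using total_degree_ge[OF v that(1-4)] that(5) by simp
  consider "v = 0" | "v = 1" | "v = 2" | "v = 3" | "v = 4" | "v = 5" | "v \<in> {6..<9}"
    using v by fastforce
  then show ?thesis
  proof cases
    case 1
    show ?thesis
      by (rule *[of "{1, 2, 3}" "{1..<9}"]) (use 1 in \<open>auto simp: adj_def\<close>)
  next
    case 2
    show ?thesis
      by (rule *[of "insert 0 {2..<9}" "{0, 2, 5}"]) (use 2 in \<open>auto simp: adj_def\<close>)
  next
    case 3
    show ?thesis
      by (rule *[of "{0, 1, 3, 4, 5}" "{0, 1, 3, 4, 5}"]) (use 3 in \<open>auto simp: adj_def\<close>)
  next
    case 4
    show ?thesis
      by (rule *[of "{0, 2, 4}" "{0, 1, 2, 4, 5} \<union> {6..<9}"]) (use 4 in \<open>auto simp: adj_def\<close>)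
  next
    case 5
    show ?thesis
      by (rule *[of "{0, 2, 3, 5} \<union> {6..<9}" "{1, 2, 3, 5} \<union> {6..<9}"])
        (use 5 in \<open>auto simp: adj_def\<close>)
  next
    case 6
    show ?thesis
      by (rule *[of "{0, 1, 2, 3, 4} \<union> {6..<9}" "{1, 2, 4}"]) (use 6 in \<open>auto simp: adj_def\<close>)
  next
    case 7
    show ?thesis
      by (rule *[of "{0, 3, 4} \<union> ({6..<9} - {v})" "{1, 4, 5} \<union> ({6..<9} - {v})"])
        (use 7 in \<open>auto simp: adj_def\<close>)
  qed
qed

theorem theorem3p6:
  fixes n :: nat
  assumes "n \<ge> 9"
  shows "\<exists>D :: (nat, nat \<times> nat) pre_digraph.
    digraph D \<and> card (verts D) = n \<and> k_strong 3 D \<and>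
    (\<forall>x \<in> verts D. total_degree D x \<ge> n + 1) \<and>
    \<not> strongly_hamiltonian_connected D"
proof -
  have n: "6 \<le> n"
    using assms by simp
  obtain B C where BC: "B \<noteq> {}" "C \<noteq> {}" "B \<union> C = {6..<n}"
    and deg: "\<And>v. v < n \<Longrightarrow> n + 1 \<le> total_degree (adj_digraph n B C) v"
  proof (cases "n = 9")
    case True
    then show ?thesis
      using that[of "{6..<9}" "{6..<9}"] total_degree_ge_9 by simp
  next
    case False
    then have "10 \<le> n"
      using assms by simp
    then show ?thesis
      using that[of "{6..<8}" "{8..<n}"] total_degree_ge_10 by (auto simp: ivl_disj_un)
  qed
  have "\<not> strongly_hamiltonian_connected (adj_digraph n B C)"
    using no_hamiltonian_path[OF n BC] n unfolding strongly_hamiltonian_connected_def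
    by (intro notI) (drule bspec[of _ _ 0], simp, drule bspec[of _ _ 1], auto)
  then show ?thesis
    using digraph_adj_digraph k_strong_adj_digraph[OF n BC(3)] deg
    by (intro exI[of _ "adj_digraph n B C"]) simp
qed

end
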